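(* The constraint selective unification problem is decidable: there is an algorithm which, given a constraint atom $C=\langle c\,|\,p(\overline{s})\rangle$ with $c$ satisfiable and two finite sets $\mathcal{H}^+$ and $\mathcal{H}^-$ of constraint atoms, such that all these constraint atoms are variable disjoint with each other and $C$ unifies with every constraint atom of $\mathcal{H}^+\cup\mathcal{H}^-$, decides whether the set $\mathcal{P}(C,\mathcal{H}^+,\mathcal{H}^-)$ is empty.
   Context: Fix a countably infinite set of variables, a signature $\Sigma=\langle F,\Pi_C\rangle$ with finite disjoint sets $F$ of function symbols and $\Pi_C$ of constraint predicate symbols (with arities), and a $\Sigma$-structure $\mathcal{D}$ with domain $D$; the symbol $=$ belongs to $\Pi_C$ and is interpreted as identity. A constraint is any first-order formula over $\Sigma$ (including $\mathsf{true}$, $\mathsf{false}$, all boolean combinations and quantifications). A valuation $v$ maps variables to $D$, and $\mathcal{D}\models_v\phi$ means that $\phi$ holds in $\mathcal D$ under $v$. A constraint is satisfiable if it holds under some valuation. Standing assumption: there is a computable function (the constraint solver) which decides, for every constraint, whether it is satisfiable in $\mathcal D$. Let $\Pi_P$ be a set of program predicate symbols disjoint from $\Pi_C$. A constraint atom is $\langle c\,|\,p(\overline{s})\rangle$ with $c$ a constraint, $p\in\Pi_P$ and $\overline{s}$ a sequence of terms. For $C=\langle c\,|\,p(\overline{s})\rangle$ and a constraint $d$, $C\wedge d=\langle c\wedge d\,|\,p(\overline{s})\rangle$. For constraint atoms $C=\langle c\,|\,p(\overline{s})\rangle$ and $C'=\langle d\,|\,p(\overline{t})\rangle$ with the same predicate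 symbol, $C\approx C'$ is the formula $\overline{s}=\overline{t}\wedge c\wedge d$ (with $\overline{s}=\overline{t}$ the conjunction of componentwise equations); with different predicate symbols it is $\mathsf{false}$. $C$ and $C'$ unify if $C\approx C'$ is satisfiable. Two objects are variable disjoint if no variable occurs (free or bound) in both. $\mathcal{P}(C,\mathcal{H}^+,\mathcal{H}^-)$ is the set of all constraint atoms $C\wedge d$, $d$ a constraint, such that: $c\wedge d$ is satisfiable; $C\wedge d$ is variable disjoint with $\mathcal{H}^+\cup\mathcal{H}^-$; for all $H\in\mathcal{H}^+$, $C\wedge d$ and $H$ unify; for all $H\in\mathcal{H}^-$, $C\wedge d$ and $H$ do not unify. *)

theory Defs
  imports Main "HOL-Library.Nat_Bijection"
begin

subsection \<open>Partial recursive functions and decidability\<close>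

datatype recf =
    Zero
  | Successor
  | Proj nat
  | Comp recf "recf list"
  | PrimRec recf recf
  | Mu recf

text \<open>\<open>rec_eval r xs y\<close>: the partial function denoted by \<open>r\<close> is defined on the argument tuple \<open>xs\<close>
  and has the value \<open>y\<close> there.  Primitive recursion is on the first argument; \<open>Mu\<close> searches for
  the least first argument that yields \<open>0\<close>, all smaller ones being required to give defined
  values.\<close>

inductive rec_eval :: "recf \<Rightarrow> nat list \<Rightarrow> nat \<Rightarrow> bool" where
  zero: "rec_eval Zero xs 0"
| successor: "rec_eval Successor [x] (Suc x)"
| proj: "i < length xs \<Longrightarrow> rec_eval (Proj i) xs (xs ! i)"
| comp: "list_all2 (\<lambda>g y. rec_eval g xs y) gs ys \<Longrightarrow> rec_eval f ys z \<Longrightarrow> rec_eval (Comp f gs) xs z"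
| primrec_0: "rec_eval f xs y \<Longrightarrow> rec_eval (PrimRec f g) (0 # xs) y"
| primrec_Suc: "rec_eval (PrimRec f g) (n # xs) y \<Longrightarrow> rec_eval g (n # y # xs) z
    \<Longrightarrow> rec_eval (PrimRec f g) (Suc n # xs) z"
| mu: "rec_eval f (n # xs) 0 \<Longrightarrow> (\<forall>m<n. \<exists>y>0. rec_eval f (m # xs) y) \<Longrightarrow> rec_eval (Mu f) xs n"

inductive_cases rec_evalE:
  "rec_eval Zero xs y"
  "rec_eval Successor xs y"
  "rec_eval (Proj i) xs y"
  "rec_eval (Comp f gs) xs y"
  "rec_eval (PrimRec f g) (0 # xs) y"
  "rec_eval (PrimRec f g) (Suc n # xs) y"
  "rec_eval (Mu f) xs y"

lemma rec_eval_deterministic: "rec_eval r xs y \<Longrightarrow> rec_eval r xs z \<Longrightarrow> y = z"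
proof (induction arbitrary: z rule: rec_eval.induct)
  case (zero xs)
  then show ?case by (rule rec_evalE(1)) simp
next
  case (successor x)
  then show ?case by (rule rec_evalE(2)) simp
next
  case (proj i xs)
  from proj.prems show ?case by (rule rec_evalE(3)) simp
next
  case (comp xs gs ys f u)
  from comp.prems obtain ys' where ys': "list_all2 (\<lambda>g y. rec_eval g xs y) gs ys'" "rec_eval f ys' z"
    by (rule rec_evalE(4))
  have "ys = ys'"
    using comp.IH(1) ys'(1) by (intro nth_equalityI) (auto simp: list_all2_conv_all_nth)
  then show ?case using comp.IH(2) ys'(2) by simp
next
  case (primrec_0 f xs y g)
  from primrec_0.prems show ?case by (rule rec_evalE(5)) (rule primrec_0.IH)
next
  case (primrec_Suc f g n xs y u)
  from primrec_Suc.prems obtain y' where y': "rec_eval (PrimRec f g) (n # xs) y'" "rec_eval g (n # y' # xs) z"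
    by (rule rec_evalE(6))
  then have "y = y'" by (intro primrec_Suc.IH(1))
  then show ?case using y'(2) by (intro primrec_Suc.IH(2)) simp
next
  case (mu f n xs)
  from mu.prems have z: "rec_eval f (z # xs) 0" "\<forall>m<z. \<exists>y>0. rec_eval f (m # xs) y"
    by (auto elim: rec_evalE(7))
  show ?case
  proof (rule linorder_cases[of n z])
    assume "n < z"
    with z(2) obtain y where "y > 0" "rec_eval f (n # xs) y" by blast
    then show ?thesis using mu.IH(1) by blast
  next
    assume "z < n"
    with mu.IH(2) obtain y where "y > 0" "\<forall>w. rec_eval f (z # xs) w \<longrightarrow> y = w" by blast
    then show ?thesis using z(1) by blast
  qed
qed

text \<open>The question \<open>P\<close> about inputs from \<open>X\<close>, coded by \<open>enc\<close> as natural numbers, is decidable: some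
  partial recursive function halts on the code of every input in \<open>X\<close> with the correct answer.
  Nothing is required of numbers that code no element of \<open>X\<close>.\<close>

definition decidable_on :: "('a \<Rightarrow> nat) \<Rightarrow> 'a set \<Rightarrow> ('a \<Rightarrow> bool) \<Rightarrow> bool" where
  "decidable_on enc X P \<longleftrightarrow> (\<exists>r. \<forall>x\<in>X. rec_eval r [enc x] (if P x then 1 else 0))"

subsection \<open>Constraints\<close>

text \<open>Function symbols, constraint predicate symbols and (below) program predicate symbols have
  different types, which makes the three kinds of symbols disjoint.  Variables are the natural
  numbers.\<close>

record ('f, 'c) fo_signature =
  funs :: "'f set"
  cpreds :: "'c set"
  fun_arity :: "'f \<Rightarrow> nat"
  cpred_arity :: "'c \<Rightarrow> nat"
  eq_sym :: 'c

definition is_signature :: "('f, 'c) fo_signature \<Rightarrow> bool" where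
  "is_signature \<Sigma> \<longleftrightarrow> finite (funs \<Sigma>) \<and> finite (cpreds \<Sigma>)
     \<and> eq_sym \<Sigma> \<in> cpreds \<Sigma> \<and> cpred_arity \<Sigma> (eq_sym \<Sigma>) = 2"

text \<open>The domain of a structure is the whole type \<open>'d\<close>.\<close>

record ('f, 'c, 'd) fo_structure =
  fun_interp :: "'f \<Rightarrow> 'd list \<Rightarrow> 'd"
  cpred_interp :: "'c \<Rightarrow> 'd list \<Rightarrow> bool"

definition is_structure :: "('f, 'c) fo_signature \<Rightarrow> ('f, 'c, 'd) fo_structure \<Rightarrow> bool" where
  "is_structure \<Sigma> \<D> \<longleftrightarrow> (\<forall>a b. cpred_interp \<D> (eq_sym \<Sigma>) [a, b] \<longleftrightarrow> a = b)"

datatype 'f trm = Var nat | Fn 'f "'f trm list"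

datatype ('f, 'c) fm =
    TT
  | FF
  | Atom 'c "'f trm list"
  | Neg "('f, 'c) fm"
  | Conj "('f, 'c) fm" "('f, 'c) fm"
  | Disj "('f, 'c) fm" "('f, 'c) fm"
  | Imp "('f, 'c) fm" "('f, 'c) fm"
  | Ex nat "('f, 'c) fm"
  | All nat "('f, 'c) fm"

fun is_term :: "('f, 'c) fo_signature \<Rightarrow> 'f trm \<Rightarrow> bool" where
  "is_term \<Sigma> (Var x) \<longleftrightarrow> True"
| "is_term \<Sigma> (Fn f ts) \<longleftrightarrow> f \<in> funs \<Sigma> \<and> length ts = fun_arity \<Sigma> f \<and> (\<forall>t\<in>set ts. is_term \<Sigma> t)"

fun is_constraint :: "('f, 'c) fo_signature \<Rightarrow> ('f, 'c) fm \<Rightarrow> bool" where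
  "is_constraint \<Sigma> TT \<longleftrightarrow> True"
| "is_constraint \<Sigma> FF \<longleftrightarrow> True"
| "is_constraint \<Sigma> (Atom q ts) \<longleftrightarrow>
     q \<in> cpreds \<Sigma> \<and> length ts = cpred_arity \<Sigma> q \<and> (\<forall>t\<in>set ts. is_term \<Sigma> t)"
| "is_constraint \<Sigma> (Neg \<phi>) \<longleftrightarrow> is_constraint \<Sigma> \<phi>"
| "is_constraint \<Sigma> (Conj \<phi> \<psi>) \<longleftrightarrow> is_constraint \<Sigma> \<phi> \<and> is_constraint \<Sigma> \<psi>"
| "is_constraint \<Sigma> (Disj \<phi> \<psi>) \<longleftrightarrow> is_constraint \<Sigma> \<phi> \<and> is_constraint \<Sigma> \<psi>"
| "is_constraint \<Sigma> (Imp \<phi> \<psi>) \<longleftrightarrow> is_constraint \<Sigma> \<phi> \<and> is_constraint \<Sigma> \<psi>"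
| "is_constraint \<Sigma> (Ex x \<phi>) \<longleftrightarrow> is_constraint \<Sigma> \<phi>"
| "is_constraint \<Sigma> (All x \<phi>) \<longleftrightarrow> is_constraint \<Sigma> \<phi>"

fun eval :: "('f, 'c, 'd) fo_structure \<Rightarrow> (nat \<Rightarrow> 'd) \<Rightarrow> 'f trm \<Rightarrow> 'd" where
  "eval \<D> v (Var x) = v x"
| "eval \<D> v (Fn f ts) = fun_interp \<D> f (map (eval \<D> v) ts)"

fun holds :: "('f, 'c, 'd) fo_structure \<Rightarrow> (nat \<Rightarrow> 'd) \<Rightarrow> ('f, 'c) fm \<Rightarrow> bool" where
  "holds \<D> v TT \<longleftrightarrow> True"
| "holds \<D> v FF \<longleftrightarrow> False"
| "holds \<D> v (Atom q ts) \<longleftrightarrow> cpred_interp \<D> q (map (eval \<D> v) ts)"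
| "holds \<D> v (Neg \<phi>) \<longleftrightarrow> \<not> holds \<D> v \<phi>"
| "holds \<D> v (Conj \<phi> \<psi>) \<longleftrightarrow> holds \<D> v \<phi> \<and> holds \<D> v \<psi>"
| "holds \<D> v (Disj \<phi> \<psi>) \<longleftrightarrow> holds \<D> v \<phi> \<or> holds \<D> v \<psi>"
| "holds \<D> v (Imp \<phi> \<psi>) \<longleftrightarrow> (holds \<D> v \<phi> \<longrightarrow> holds \<D> v \<psi>)"
| "holds \<D> v (Ex x \<phi>) \<longleftrightarrow> (\<exists>a. holds \<D> (v(x := a)) \<phi>)"
| "holds \<D> v (All x \<phi>) \<longleftrightarrow> (\<forall>a. holds \<D> (v(x := a)) \<phi>)"

definition satisfiable :: "('f, 'c, 'd) fo_structure \<Rightarrow> ('f, 'c) fm \<Rightarrow> bool" where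
  "satisfiable \<D> \<phi> \<longleftrightarrow> (\<exists>v. holds \<D> v \<phi>)"

fun vars_trm :: "'f trm \<Rightarrow> nat set" where
  "vars_trm (Var x) = {x}"
| "vars_trm (Fn f ts) = (\<Union>t\<in>set ts. vars_trm t)"

text \<open>All variables that occur, free or bound; a quantified variable occurs even if it does not
  occur in the scope of its quantifier.\<close>

fun vars_fm :: "('f, 'c) fm \<Rightarrow> nat set" where
  "vars_fm TT = {}"
| "vars_fm FF = {}"
| "vars_fm (Atom q ts) = (\<Union>t\<in>set ts. vars_trm t)"
| "vars_fm (Neg \<phi>) = vars_fm \<phi>"
| "vars_fm (Conj \<phi> \<psi>) = vars_fm \<phi> \<union> vars_fm \<psi>"
| "vars_fm (Disj \<phi> \<psi>) = vars_fm \<phi> \<union> vars_fm \<psi>"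
| "vars_fm (Imp \<phi> \<psi>) = vars_fm \<phi> \<union> vars_fm \<psi>"
| "vars_fm (Ex x \<phi>) = insert x (vars_fm \<phi>)"
| "vars_fm (All x \<phi>) = insert x (vars_fm \<phi>)"

subsection \<open>Constraint atoms\<close>

datatype ('f, 'c, 'p) catom = CAtom "('f, 'c) fm" 'p "'f trm list"

fun constr_of :: "('f, 'c, 'p) catom \<Rightarrow> ('f, 'c) fm" where
  "constr_of (CAtom c p ss) = c"

fun is_catom :: "('f, 'c) fo_signature \<Rightarrow> 'p set \<Rightarrow> ('p \<Rightarrow> nat) \<Rightarrow> ('f, 'c, 'p) catom \<Rightarrow> bool" where
  "is_catom \<Sigma> PP ar (CAtom c p ss) \<longleftrightarrow>
     is_constraint \<Sigma> c \<and> p \<in> PP \<and> length ss = ar p \<and> (\<forall>s\<in>set ss. is_term \<Sigma> s)"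

fun vars_catom :: "('f, 'c, 'p) catom \<Rightarrow> nat set" where
  "vars_catom (CAtom c p ss) = vars_fm c \<union> (\<Union>s\<in>set ss. vars_trm s)"

definition var_disjoint :: "('f, 'c, 'p) catom \<Rightarrow> ('f, 'c, 'p) catom \<Rightarrow> bool" where
  "var_disjoint C C' \<longleftrightarrow> vars_catom C \<inter> vars_catom C' = {}"

fun and_constr :: "('f, 'c, 'p) catom \<Rightarrow> ('f, 'c) fm \<Rightarrow> ('f, 'c, 'p) catom" where
  "and_constr (CAtom c p ss) d = CAtom (Conj c d) p ss"

text \<open>Only used for lists of equal length.\<close>

definition term_eqs :: "('f, 'c) fo_signature \<Rightarrow> 'f trm list \<Rightarrow> 'f trm list \<Rightarrow> ('f, 'c) fm" where
  "term_eqs \<Sigma> ss ts = foldr Conj (map (\<lambda>(s, t). Atom (eq_sym \<Sigma>) [s, t]) (zip ss ts)) TT"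

fun approx :: "('f, 'c) fo_signature \<Rightarrow> ('f, 'c, 'p) catom \<Rightarrow> ('f, 'c, 'p) catom \<Rightarrow> ('f, 'c) fm" where
  "approx \<Sigma> (CAtom c p ss) (CAtom d q ts) =
     (if p = q then Conj (term_eqs \<Sigma> ss ts) (Conj c d) else FF)"

definition unify :: "('f, 'c) fo_signature \<Rightarrow> ('f, 'c, 'd) fo_structure
    \<Rightarrow> ('f, 'c, 'p) catom \<Rightarrow> ('f, 'c, 'p) catom \<Rightarrow> bool" where
  "unify \<Sigma> \<D> C C' \<longleftrightarrow> satisfiable \<D> (approx \<Sigma> C C')"

subsection \<open>Constraint selective unification\<close>

definition selective :: "('f, 'c) fo_signature \<Rightarrow> ('f, 'c, 'd) fo_structure \<Rightarrow> ('f, 'c, 'p) catom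
    \<Rightarrow> ('f, 'c, 'p) catom set \<Rightarrow> ('f, 'c, 'p) catom set \<Rightarrow> ('f, 'c, 'p) catom set" where
  "selective \<Sigma> \<D> C Hpos Hneg = {and_constr C d | d.
     is_constraint \<Sigma> d
     \<and> satisfiable \<D> (constr_of (and_constr C d))
     \<and> (\<forall>H \<in> Hpos \<union> Hneg. var_disjoint (and_constr C d) H)
     \<and> (\<forall>H \<in> Hpos. unify \<Sigma> \<D> (and_constr C d) H)
     \<and> (\<forall>H \<in> Hneg. \<not> unify \<Sigma> \<D> (and_constr C d) H)}"

definition csu_instance :: "('f, 'c) fo_signature \<Rightarrow> ('f, 'c, 'd) fo_structure
    \<Rightarrow> 'p set \<Rightarrow> ('p \<Rightarrow> nat) \<Rightarrow> ('f, 'c, 'p) catom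
    \<Rightarrow> ('f, 'c, 'p) catom set \<Rightarrow> ('f, 'c, 'p) catom set \<Rightarrow> bool" where
  "csu_instance \<Sigma> \<D> PP ar C Hpos Hneg \<longleftrightarrow>
     is_catom \<Sigma> PP ar C \<and> satisfiable \<D> (constr_of C)
     \<and> finite Hpos \<and> finite Hneg
     \<and> (\<forall>H \<in> Hpos \<union> Hneg. is_catom \<Sigma> PP ar H)
     \<and> (\<forall>H \<in> Hpos \<union> Hneg. var_disjoint C H)
     \<and> (\<forall>H \<in> Hpos \<union> Hneg. \<forall>H' \<in> Hpos \<union> Hneg. H \<noteq> H' \<longrightarrow> var_disjoint H H')
     \<and> (\<forall>H \<in> Hpos \<union> Hneg. unify \<Sigma> \<D> C H)"

subsection \<open>Coding of syntax by natural numbers\<close>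

text \<open>The parameters \<open>nf\<close>, \<open>nc\<close> and \<open>np\<close> number the function symbols, the constraint predicate
  symbols and the program predicate symbols.\<close>

fun enc_trm :: "('f \<Rightarrow> nat) \<Rightarrow> 'f trm \<Rightarrow> nat" where
  "enc_trm nf (Var x) = prod_encode (0, x)"
| "enc_trm nf (Fn f ts) = prod_encode (1, prod_encode (nf f, list_encode (map (enc_trm nf) ts)))"

fun enc_fm :: "('f \<Rightarrow> nat) \<Rightarrow> ('c \<Rightarrow> nat) \<Rightarrow> ('f, 'c) fm \<Rightarrow> nat" where
  "enc_fm nf nc TT = prod_encode (0, 0)"
| "enc_fm nf nc FF = prod_encode (1, 0)"
| "enc_fm nf nc (Atom q ts) = prod_encode (2, prod_encode (nc q, list_encode (map (enc_trm nf) ts)))"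
| "enc_fm nf nc (Neg \<phi>) = prod_encode (3, enc_fm nf nc \<phi>)"
| "enc_fm nf nc (Conj \<phi> \<psi>) = prod_encode (4, prod_encode (enc_fm nf nc \<phi>, enc_fm nf nc \<psi>))"
| "enc_fm nf nc (Disj \<phi> \<psi>) = prod_encode (5, prod_encode (enc_fm nf nc \<phi>, enc_fm nf nc \<psi>))"
| "enc_fm nf nc (Imp \<phi> \<psi>) = prod_encode (6, prod_encode (enc_fm nf nc \<phi>, enc_fm nf nc \<psi>))"
| "enc_fm nf nc (Ex x \<phi>) = prod_encode (7, prod_encode (x, enc_fm nf nc \<phi>))"
| "enc_fm nf nc (All x \<phi>) = prod_encode (8, prod_encode (x, enc_fm nf nc \<phi>))"

fun enc_catom :: "('f \<Rightarrow> nat) \<Rightarrow> ('c \<Rightarrow> nat) \<Rightarrow> ('p \<Rightarrow> nat) \<Rightarrow> ('f, 'c, 'p) catom \<Rightarrow> nat" where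
  "enc_catom nf nc np (CAtom c p ss) =
     prod_encode (enc_fm nf nc c, prod_encode (np p, list_encode (map (enc_trm nf) ss)))"

text \<open>The two finite sets of an input are presented by lists of their elements, in any order and
  possibly with repetitions.\<close>

fun enc_input :: "('f \<Rightarrow> nat) \<Rightarrow> ('c \<Rightarrow> nat) \<Rightarrow> ('p \<Rightarrow> nat)
    \<Rightarrow> ('f, 'c, 'p) catom \<times> ('f, 'c, 'p) catom list \<times> ('f, 'c, 'p) catom list \<Rightarrow> nat" where
  "enc_input nf nc np (C, hpos, hneg) =
     prod_encode (enc_catom nf nc np C,
       prod_encode (list_encode (map (enc_catom nf nc np) hpos),
                    list_encode (map (enc_catom nf nc np) hneg)))"

lemma enc_trm_inj:
  assumes nf: "inj_on nf (funs \<Sigma>)"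
  shows "is_term \<Sigma> s \<Longrightarrow> is_term \<Sigma> t \<Longrightarrow> enc_trm nf s = enc_trm nf t \<Longrightarrow> s = t"
proof (induction s arbitrary: t)
  case (Var x)
  then show ?case by (cases t) auto
next
  case (Fn f ss)
  then obtain g ts where t: "t = Fn g ts" by (cases t) auto
  from Fn.prems t have "f = g" and m: "map (enc_trm nf) ss = map (enc_trm nf) ts"
    using nf by (auto simp: list_encode_eq dest: inj_onD)
  have len: "length ss = length ts" using m by (rule map_eq_imp_length_eq)
  have "ss = ts"
  proof (rule nth_equalityI[OF len])
    fix i assume i: "i < length ss"
    have "enc_trm nf (ss ! i) = enc_trm nf (ts ! i)"
      using arg_cong[OF m, of "\<lambda>l. l ! i"] i len by simp
    then show "ss ! i = ts ! i"
      using Fn.IH[of "ss ! i" "ts ! i"] Fn.prems(1,2) i len t by simp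
  qed
  then show ?case using \<open>f = g\<close> t by simp
qed

lemma enc_trms_inj:
  assumes "inj_on nf (funs \<Sigma>)" "\<forall>s\<in>set ss. is_term \<Sigma> s" "\<forall>t\<in>set ts. is_term \<Sigma> t"
    and "map (enc_trm nf) ss = map (enc_trm nf) ts"
  shows "ss = ts"
proof -
  have "inj_on (enc_trm nf) (set ss \<union> set ts)"
    using assms(2,3) by (intro inj_onI) (blast intro: enc_trm_inj[OF assms(1)])
  then show ?thesis using assms(4) by (simp add: inj_on_map_eq_map)
qed

lemma enc_fm_inj:
  assumes nf: "inj_on nf (funs \<Sigma>)" and nc: "inj_on nc (cpreds \<Sigma>)"
  shows "is_constraint \<Sigma> \<phi> \<Longrightarrow> is_constraint \<Sigma> \<psi> \<Longrightarrow> enc_fm nf nc \<phi> = enc_fm nf nc \<psi> \<Longrightarrow> \<phi> = \<psi>"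
proof (induction \<phi> arbitrary: \<psi>)
  case (Atom q ts)
  then show ?case
    using nc enc_trms_inj[OF nf] by (cases \<psi>) (auto simp: list_encode_eq dest: inj_onD)
qed (case_tac \<psi>; simp)+

lemma enc_catom_inj:
  assumes "inj_on nf (funs \<Sigma>)" "inj_on nc (cpreds \<Sigma>)" "inj_on np PP"
    and "is_catom \<Sigma> PP ar C" "is_catom \<Sigma> PP ar C'" "enc_catom nf nc np C = enc_catom nf nc np C'"
  shows "C = C'"
  using assms(3-6) enc_fm_inj[OF assms(1,2)] enc_trms_inj[OF assms(1)]
  by (cases C; cases C') (auto simp: list_encode_eq dest: inj_onD)

end

theory Submission
  imports Defs
begin

text \<open>Let \<open>solutions H\<close> be the set of value tuples of \<open>t\<close> that a constraint atom
  \<open>H = \<langle>e | p(t)\<rangle>\<close> admits. Since the atoms are variable disjoint, unifiability means that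
  the sets of solutions meet, and the largest sensible choice of \<open>d\<close> cuts the solutions of \<open>C\<close>
  down to those outside all solutions of the negative atoms; that set is definable. So the selective
  set is nonempty iff every atom of \<open>C # hpos\<close> has a solution in this difference.
  All these conditions together say that one closed formula holds, and its code is computable
  from the code of the input. No set of variables has to be computed: with \<open>B\<close>
  larger than the code of the input, quantifying all variables below \<open>B\<close> is enough, the
  common tuple being held by the variables \<open>B, B + 1, \<dots>\<close>.\<close>

section \<open>Computable functions\<close>

text \<open>Total functions of one argument suffice: every intermediate quantity is regarded as a
  function of the single input \<open>x\<close>, so closure rules handle compound expressions, and
  further arguments travel inside pairs.\<close>

definition computable :: "(nat \<Rightarrow> nat) \<Rightarrow> bool" where
  "computable f \<longleftrightarrow> (\<exists>r. \<forall>x. rec_eval r [x] (f x))"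

lemma rec_eval_Proj: "i < length xs \<Longrightarrow> y = xs ! i \<Longrightarrow> rec_eval (Proj i) xs y"
  by (simp add: rec_eval.proj)

lemma rec_eval_Comp1:
  "rec_eval g xs y \<Longrightarrow> rec_eval f [y] z \<Longrightarrow> rec_eval (Comp f [g]) xs z"
  by (rule rec_eval.comp[of xs "[g]" "[y]"]) auto

lemma rec_eval_Comp2:
  "rec_eval g xs y \<Longrightarrow> rec_eval h xs y' \<Longrightarrow> rec_eval f [y, y'] z
    \<Longrightarrow> rec_eval (Comp f [g, h]) xs z"
  by (rule rec_eval.comp[of xs "[g, h]" "[y, y']"]) auto

section \<open>Arithmetic and the pairing function as recursive functions\<close>

definition "add_recf = PrimRec (Proj 0) (Comp Successor [Proj 1])"
definition "pred_recf = PrimRec Zero (Proj 0)"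
text \<open>Primitive recursion runs on the first argument, so the subtrahend comes first; in the
  step function \<open>Proj 1\<close> is the previous value.\<close>

definition "sub_recf = PrimRec (Proj 0) (Comp pred_recf [Proj 1])"
definition "triangle_recf = PrimRec Zero (Comp add_recf [Proj 1, Comp Successor [Proj 0]])"
definition "pair_recf = Comp add_recf [Comp triangle_recf [add_recf], Proj 0]"

lemma add_recf: "rec_eval add_recf [m, n] (m + n)"
  unfolding add_recf_def
proof (induction m)
  case 0
  show ?case by (auto intro!: rec_eval.primrec_0 rec_eval_Proj)
next
  case (Suc m)
  show ?case
    by (rule rec_eval.primrec_Suc[OF Suc])
      (auto intro!: rec_eval_Comp1 rec_eval_Proj rec_eval.successor)
qed

lemma pred_recf: "rec_eval pred_recf [m] (m - 1)"
  unfolding pred_recf_def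
proof (induction m)
  case 0
  show ?case by (auto intro!: rec_eval.primrec_0 rec_eval.zero)
next
  case (Suc m)
  show ?case by (rule rec_eval.primrec_Suc[OF Suc]) (auto intro!: rec_eval_Proj)
qed

lemma sub_recf: "rec_eval sub_recf [n, m] (m - n)"
  unfolding sub_recf_def
proof (induction n)
  case 0
  show ?case by (auto intro!: rec_eval.primrec_0 rec_eval_Proj)
next
  case (Suc n)
  have "rec_eval pred_recf [m - n] (m - Suc n)" using pred_recf[of "m - n"] by simp
  then show ?case
    by (intro rec_eval.primrec_Suc[OF Suc] rec_eval_Comp1[OF rec_eval_Proj]) auto
qed

lemma triangle_recf: "rec_eval triangle_recf [n] (triangle n)"
  unfolding triangle_recf_def
proof (induction n)
  case 0
  show ?case by (auto intro!: rec_eval.primrec_0 rec_eval.zero)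
next
  case (Suc n)
  show ?case unfolding triangle_Suc
    by (rule rec_eval.primrec_Suc[OF Suc], rule rec_eval_Comp2[OF _ _ add_recf])
      (auto intro!: rec_eval_Comp1 rec_eval_Proj rec_eval.successor)
qed

lemma pair_recf: "rec_eval pair_recf [m, n] (prod_encode (m, n))"
  unfolding pair_recf_def prod_encode_def prod.case
  by (rule rec_eval_Comp2[OF rec_eval_Comp1[OF add_recf triangle_recf] rec_eval_Proj add_recf]) auto

section \<open>Closure properties of computable functions\<close>

lemma computable_id: "computable (\<lambda>x. x)"
  unfolding computable_def by (auto intro!: exI[of _ "Proj 0"] rec_eval_Proj)

lemma computable_const: "computable (\<lambda>x. n)"
proof (induction n)
  case 0
  show ?case unfolding computable_def using rec_eval.zero by blast
next
  case (Suc n)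
  then show ?case unfolding computable_def using rec_eval_Comp1 rec_eval.successor by metis
qed

lemma computable_Suc: "computable f \<Longrightarrow> computable (\<lambda>x. Suc (f x))"
  unfolding computable_def using rec_eval_Comp1 rec_eval.successor by metis

lemma computable_comp: "computable f \<Longrightarrow> computable g \<Longrightarrow> computable (\<lambda>x. f (g x))"
  unfolding computable_def using rec_eval_Comp1 by metis

lemma computable_pred: "computable f \<Longrightarrow> computable (\<lambda>x. f x - 1)"
  unfolding computable_def using rec_eval_Comp1 pred_recf by metis

lemma computable_binary:
  assumes "\<And>m n. rec_eval r [m, n] (F m n)" "computable f" "computable g"
  shows "computable (\<lambda>x. F (f x) (g x))"
proof -
  obtain rf rg where "\<And>x. rec_eval rf [x] (f x)" "\<And>x. rec_eval rg [x] (g x)"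
    using assms(2,3) unfolding computable_def by metis
  then have "rec_eval (Comp r [rf, rg]) [x] (F (f x) (g x))" for x
    by (rule rec_eval_Comp2) (rule assms(1))
  then show ?thesis unfolding computable_def by blast
qed

lemmas computable_add = computable_binary[OF add_recf]
lemmas computable_sub = computable_binary[OF sub_recf]
lemmas computable_pair = computable_binary[OF pair_recf]

lemma computable_triangle: "computable f \<Longrightarrow> computable (\<lambda>x. triangle (f x))"
  unfolding computable_def using rec_eval_Comp1 triangle_recf by metis

section \<open>Inverting the pairing function\<close>

definition pfst :: "nat \<Rightarrow> nat" where "pfst z = fst (prod_decode z)"
definition psnd :: "nat \<Rightarrow> nat" where "psnd z = snd (prod_decode z)"

lemma pfst_pair [simp]: "pfst (prod_encode (a, b)) = a" by (simp add: pfst_def)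
lemma psnd_pair [simp]: "psnd (prod_encode (a, b)) = b" by (simp add: psnd_def)

lemma triangle_mono: "m \<le> n \<Longrightarrow> triangle m \<le> triangle n"
  by (induction n) (auto simp: le_Suc_eq)

text \<open>The pairs with sum \<open>k\<close> are coded by the numbers from \<open>triangle k\<close> to
  \<open>triangle (Suc k) - 1\<close>, so unpairing searches for the least \<open>k\<close> with
  \<open>z < triangle (Suc k)\<close>.\<close>

lemma computable_pair_sum: "computable (\<lambda>z. pfst z + psnd z)"
proof -
  define r where "r = Comp sub_recf [Comp triangle_recf [Comp Successor [Proj 0]], Comp Successor [Proj 1]]"
  \<comment> \<open>The extra successor turns the strict test into a zero test: the truncated
    difference is 0 exactly when \<open>z < triangle (Suc k)\<close>.\<close>
  have r: "rec_eval r [k, z] (Suc z - triangle (Suc k))" for k z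
    unfolding r_def
    by (rule rec_eval_Comp2[OF rec_eval_Comp1[OF _ triangle_recf] _ sub_recf])
      (auto intro!: rec_eval_Comp1 rec_eval_Proj rec_eval.successor)
  have "rec_eval (Mu r) [z] (pfst z + psnd z)" for z
  proof -
    obtain a b where ab: "prod_decode z = (a, b)" by fastforce
    then have z: "z = triangle (a + b) + a"
      using prod_decode_inverse[of z] by (simp add: prod_encode_def)
    have "rec_eval (Mu r) [z] (a + b)"
    proof (rule rec_eval.mu)
      show "rec_eval r [a + b, z] 0" using r[of "a + b" z] z by simp
      show "\<forall>m<a + b. \<exists>y>0. rec_eval r [m, z] y"
      proof (intro allI impI)
        fix m assume "m < a + b"
        then have "triangle (Suc m) \<le> triangle (a + b)" by (intro triangle_mono) simp
        then show "\<exists>y>0. rec_eval r [m, z] y" using r[of m z] z by (metis diff_is_0_eq gr0I le_SucI le_add1 le_trans not_less_eq_eq)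
      qed
    qed
    then show ?thesis using ab by (simp add: pfst_def psnd_def)
  qed
  then show ?thesis unfolding computable_def by blast
qed

text \<open>The code of a pair is the triangle of its sum plus its first component. Once the sum is
  known, one subtraction yields the first component and a second one, from the sum, yields the
  other.\<close>

lemma computable_pfst: "computable f \<Longrightarrow> computable (\<lambda>x. pfst (f x))"
proof -
  have "z - triangle (pfst z + psnd z) = pfst z" for z
  proof -
    have "z = prod_encode (pfst z, psnd z)" by (simp add: pfst_def psnd_def)
    then show ?thesis by (simp add: prod_encode_def)
  qed
  moreover have "computable (\<lambda>z. z - triangle (pfst z + psnd z))"
    by (intro computable_sub computable_triangle computable_pair_sum computable_id)
  ultimately show "computable f \<Longrightarrow> computable (\<lambda>x. pfst (f x))"
    by (simp add: computable_comp[of pfst])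
qed

lemma computable_psnd: "computable f \<Longrightarrow> computable (\<lambda>x. psnd (f x))"
proof -
  have "computable (\<lambda>z. (pfst z + psnd z) - pfst z)"
    by (intro computable_sub computable_pair_sum computable_pfst computable_id)
  then show "computable f \<Longrightarrow> computable (\<lambda>x. psnd (f x))"
    by (simp add: computable_comp[of psnd])
qed

lemma computable_If:
  assumes "computable f" "computable g" "computable h"
  shows "computable (\<lambda>x. if f x = 0 then g x else h x)"
proof -
  obtain rf rg rh where r: "\<And>x. rec_eval rf [x] (f x)" "\<And>x. rec_eval rg [x] (g x)"
    "\<And>x. rec_eval rh [x] (h x)"
    using assms unfolding computable_def by metis
  \<comment> \<open>Primitive recursion serves as a case distinction: the step function ignores the
    previous value and applies \<open>rh\<close> to the input, which is its third argument.\<close>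
  let ?r = "PrimRec rg (Comp rh [Proj 2])"
  have "rec_eval ?r [n, x] (if n = 0 then g x else h x)" for n x
  proof (induction n)
    case 0
    show ?case by (simp add: rec_eval.primrec_0 r)
  next
    case (Suc n)
    show ?case
      using rec_eval.primrec_Suc[OF Suc rec_eval_Comp1[OF rec_eval_Proj r(3)]] by simp
  qed
  then have "rec_eval (Comp ?r [rf, Proj 0]) [x] (if f x = 0 then g x else h x)" for x
    by (rule rec_eval_Comp2[OF r(1) rec_eval_Proj, rotated 2]) simp_all
  then show ?thesis unfolding computable_def by blast
qed

text \<open>The iterated \<open>f\<close> is the same for all inputs, so whatever a loop needs from
  \<open>x\<close> has to be carried in its state.\<close>

lemma computable_funpow:
  assumes "computable f" "computable n" "computable a"
  shows "computable (\<lambda>x. (f ^^ n x) (a x))"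
proof -
  obtain rf rn ra where r: "\<And>x. rec_eval rf [x] (f x)" "\<And>x. rec_eval rn [x] (n x)"
    "\<And>x. rec_eval ra [x] (a x)"
    using assms unfolding computable_def by metis
  let ?r = "PrimRec ra (Comp rf [Proj 1])"
  have "rec_eval ?r [m, x] ((f ^^ m) (a x))" for m x
  proof (induction m)
    case 0
    show ?case by (simp add: rec_eval.primrec_0 r)
  next
    case (Suc m)
    show ?case
      using rec_eval.primrec_Suc[OF Suc rec_eval_Comp1[OF rec_eval_Proj r(1)]] by simp
  qed
  then have "rec_eval (Comp ?r [rn, Proj 0]) [x] ((f ^^ n x) (a x))" for x
    by (intro rec_eval_Comp2[OF r(2) rec_eval_Proj]) auto
  then show ?thesis unfolding computable_def by blast
qed

text \<open>The folded function has to be one fixed unary function. Hence it receives element,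
  parameter \<open>p\<close> and accumulator as a coded triple, and \<open>p\<close> is the channel
  for data that depend on the input.\<close>

definition fold_code :: "(nat \<Rightarrow> nat) \<Rightarrow> nat \<Rightarrow> nat \<Rightarrow> nat \<Rightarrow> nat" where
  "fold_code f p l a =
     fold (\<lambda>h acc. f (prod_encode (h, prod_encode (p, acc)))) (list_decode l) a"

lemma length_le_list_encode: "length xs \<le> list_encode xs"
proof (induction xs)
  case (Cons x xs)
  then show ?case using le_prod_encode_2[of "list_encode xs" x] by simp
qed simp

lemma member_le_list_encode: "x \<in> set xs \<Longrightarrow> x \<le> list_encode xs"
proof (induction xs)
  case (Cons y ys)
  then show ?case
    using le_prod_encode_1[of y "list_encode ys"] le_prod_encode_2[of "list_encode ys" y] by auto
qed simp

lemma computable_fold_code: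
  assumes "computable f" "computable p" "computable l" "computable a"
  shows "computable (\<lambda>x. fold_code f (p x) (l x) (a x))"
proof -
  \<comment> \<open>The state is (code of the remaining list, (parameter, accumulator)). A nonempty
    list is coded as the successor of the pair of head and code of the tail, the empty one as 0;
    there \<open>step\<close> is the identity, so surplus iterations do no harm.\<close>
  define step where "step = (\<lambda>s. if pfst s = 0 then s else
     prod_encode (psnd (pfst s - 1), prod_encode (pfst (psnd s),
       f (prod_encode (pfst (pfst s - 1), psnd s)))))"
  have step: "computable step"
    unfolding step_def
    by (intro computable_If computable_pair computable_pfst computable_psnd computable_pred
        computable_comp[OF assms(1)] computable_id)
  have iter: "(step ^^ k) (prod_encode (list_encode xs, prod_encode (q, b)))
      = prod_encode (0, prod_encode (q, fold (\<lambda>h acc. f (prod_encode (h, prod_encode (q, acc)))) xs b))"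
    if "length xs \<le> k" for k xs q b
    using that
  proof (induction xs arbitrary: k b)
    case Nil
    show ?case by (induction k) (auto simp: step_def)
  next
    case (Cons y ys)
    then obtain j where j: "k = Suc j" "length ys \<le> j" by (cases k) auto
    show ?case unfolding j(1) funpow_Suc_right
      using Cons.IH[OF j(2)] by (simp add: step_def)
  qed
  have "fold_code f q m b
      = psnd (psnd ((step ^^ m) (prod_encode (m, prod_encode (q, b)))))" for q m b
    using iter[of "list_decode m" m q b] length_le_list_encode[of "list_decode m"]
    by (simp add: fold_code_def)
  then show ?thesis
    using assms by (simp add: computable_psnd computable_funpow[OF step] computable_pair)
qed

lemmas computable_intros = computable_const computable_id computable_Suc computable_add
  computable_pair computable_pfst computable_psnd

section \<open>Semantics of constraints\<close>

lemma eval_cong: "(\<And>x. x \<in> vars_trm t \<Longrightarrow> v x = w x) \<Longrightarrow> eval \<D> v t = eval \<D> w t"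
proof (induction t)
  case (Fn f ts)
  then have "map (eval \<D> v) ts = map (eval \<D> w) ts" by (intro map_cong) auto
  then show ?case by (simp only: eval.simps)
qed simp

lemma map_eval_cong:
  "(\<And>t x. t \<in> set ts \<Longrightarrow> x \<in> vars_trm t \<Longrightarrow> v x = w x) \<Longrightarrow> map (eval \<D> v) ts = map (eval \<D> w) ts"
  by (auto intro: eval_cong)

text \<open>Occurrence includes bound variables, so the assumption passes directly to the body of a
  quantifier, where both valuations are updated alike.\<close>

lemma holds_cong: "(\<And>x. x \<in> vars_fm \<phi> \<Longrightarrow> v x = w x) \<Longrightarrow> holds \<D> v \<phi> = holds \<D> w \<phi>"
proof (induction \<phi> arbitrary: v w)
  case (Atom q ts)
  then have "map (eval \<D> v) ts = map (eval \<D> w) ts" by (intro map_eval_cong) auto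
  then show ?case by (simp only: holds.simps)
next
  case (Ex x \<phi>)
  have "holds \<D> (v(x := a)) \<phi> = holds \<D> (w(x := a)) \<phi>" for a
    by (rule Ex.IH) (use Ex.prems in auto)
  then show ?case by simp
next
  case (All x \<phi>)
  have "holds \<D> (v(x := a)) \<phi> = holds \<D> (w(x := a)) \<phi>" for a
    by (rule All.IH) (use All.prems in auto)
  then show ?case by simp
next
  case (Conj \<phi> \<psi>) then show ?case by (metis UnCI holds.simps(5) vars_fm.simps(5))
next
  case (Disj \<phi> \<psi>) then show ?case by (metis UnCI holds.simps(6) vars_fm.simps(6))
next
  case (Imp \<phi> \<psi>) then show ?case by (metis UnCI holds.simps(7) vars_fm.simps(7))
next
  case (Neg \<phi>) then show ?case by (metis holds.simps(4) vars_fm.simps(4))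
qed simp_all

section \<open>Renaming of variables, free and bound\<close>

fun rename_trm :: "(nat \<Rightarrow> nat) \<Rightarrow> 'f trm \<Rightarrow> 'f trm" where
  "rename_trm \<rho> (Var x) = Var (\<rho> x)"
| "rename_trm \<rho> (Fn f ts) = Fn f (map (rename_trm \<rho>) ts)"

fun rename_fm :: "(nat \<Rightarrow> nat) \<Rightarrow> ('f, 'c) fm \<Rightarrow> ('f, 'c) fm" where
  "rename_fm \<rho> TT = TT"
| "rename_fm \<rho> FF = FF"
| "rename_fm \<rho> (Atom q ts) = Atom q (map (rename_trm \<rho>) ts)"
| "rename_fm \<rho> (Neg \<phi>) = Neg (rename_fm \<rho> \<phi>)"
| "rename_fm \<rho> (Conj \<phi> \<psi>) = Conj (rename_fm \<rho> \<phi>) (rename_fm \<rho> \<psi>)"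
| "rename_fm \<rho> (Disj \<phi> \<psi>) = Disj (rename_fm \<rho> \<phi>) (rename_fm \<rho> \<psi>)"
| "rename_fm \<rho> (Imp \<phi> \<psi>) = Imp (rename_fm \<rho> \<phi>) (rename_fm \<rho> \<psi>)"
| "rename_fm \<rho> (Ex x \<phi>) = Ex (\<rho> x) (rename_fm \<rho> \<phi>)"
| "rename_fm \<rho> (All x \<phi>) = All (\<rho> x) (rename_fm \<rho> \<phi>)"

lemma is_term_rename: "is_term \<Sigma> t \<Longrightarrow> is_term \<Sigma> (rename_trm \<rho> t)"
  by (induction t) auto

lemma is_constraint_rename: "is_constraint \<Sigma> \<phi> \<Longrightarrow> is_constraint \<Sigma> (rename_fm \<rho> \<phi>)"
  by (induction \<phi>) (auto simp: is_term_rename)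

lemma vars_rename_trm: "vars_trm (rename_trm \<rho> t) = \<rho> ` vars_trm t"
  by (induction t) auto

lemma vars_rename_fm: "vars_fm (rename_fm \<rho> \<phi>) = \<rho> ` vars_fm \<phi>"
  by (induction \<phi>) (auto simp: vars_rename_trm)

lemma eval_rename: "eval \<D> v (rename_trm \<rho> t) = eval \<D> (v \<circ> \<rho>) t"
  by (induction t) (auto intro!: arg_cong[of _ _ "fun_interp \<D> _"])

text \<open>Injectivity excludes capture: changing \<open>v\<close> at \<open>\<rho> x\<close>
  changes \<open>v \<circ> \<rho>\<close> at \<open>x\<close> only.\<close>

lemma holds_rename: "inj \<rho> \<Longrightarrow> holds \<D> v (rename_fm \<rho> \<phi>) = holds \<D> (v \<circ> \<rho>) \<phi>"
proof (induction \<phi> arbitrary: v)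
  case (Atom q ts)
  then show ?case by (simp add: eval_rename comp_def)
next
  case (Ex x \<phi>)
  have "v(\<rho> x := a) \<circ> \<rho> = (v \<circ> \<rho>)(x := a)" for a
    using Ex.prems by (auto simp: fun_eq_iff inj_eq)
  then show ?case using Ex by (simp only: rename_fm.simps holds.simps)
next
  case (All x \<phi>)
  have "v(\<rho> x := a) \<circ> \<rho> = (v \<circ> \<rho>)(x := a)" for a
    using All.prems by (auto simp: fun_eq_iff inj_eq)
  then show ?case using All by (simp only: rename_fm.simps holds.simps)
qed simp_all

section \<open>Quantifier blocks, finite conjunctions and systems of equations\<close>

definition exs :: "nat list \<Rightarrow> ('f, 'c) fm \<Rightarrow> ('f, 'c) fm" where
  "exs xs \<phi> = fold Ex xs \<phi>"

lemma holds_exs: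
  "holds \<D> v (exs xs \<phi>) \<longleftrightarrow> (\<exists>w. (\<forall>i. i \<notin> set xs \<longrightarrow> w i = v i) \<and> holds \<D> w \<phi>)"
proof (induction xs arbitrary: \<phi>)
  case Nil
  have "(\<forall>i. w i = v i) \<longleftrightarrow> w = v" for w by (auto simp: fun_eq_iff)
  then show ?case by (simp add: exs_def)
next
  case (Cons x xs)
  have "holds \<D> v (exs (x # xs) \<phi>) \<longleftrightarrow> holds \<D> v (exs xs (Ex x \<phi>))" by (simp add: exs_def)
  also have "\<dots> \<longleftrightarrow> (\<exists>w. (\<forall>i. i \<notin> set xs \<longrightarrow> w i = v i) \<and> (\<exists>a. holds \<D> (w(x := a)) \<phi>))"
    by (simp add: Cons.IH)
  also have "\<dots> \<longleftrightarrow> (\<exists>u. (\<forall>i. i \<notin> set (x # xs) \<longrightarrow> u i = v i) \<and> holds \<D> u \<phi>)"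
  proof
    assume "\<exists>w. (\<forall>i. i \<notin> set xs \<longrightarrow> w i = v i) \<and> (\<exists>a. holds \<D> (w(x := a)) \<phi>)"
    then obtain w a where "\<forall>i. i \<notin> set xs \<longrightarrow> w i = v i" "holds \<D> (w(x := a)) \<phi>" by blast
    then show "\<exists>u. (\<forall>i. i \<notin> set (x # xs) \<longrightarrow> u i = v i) \<and> holds \<D> u \<phi>"
      by (intro exI[of _ "w(x := a)"]) auto
  next
    assume "\<exists>u. (\<forall>i. i \<notin> set (x # xs) \<longrightarrow> u i = v i) \<and> holds \<D> u \<phi>"
    then obtain u where u: "\<forall>i. i \<notin> set (x # xs) \<longrightarrow> u i = v i" "holds \<D> u \<phi>" by blast
    show "\<exists>w. (\<forall>i. i \<notin> set xs \<longrightarrow> w i = v i) \<and> (\<exists>a. holds \<D> (w(x := a)) \<phi>)"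
    proof (intro exI conjI)
      \<comment> \<open>Resetting \<open>x\<close> to \<open>v x\<close> makes the valuation agree
        with \<open>v\<close> outside \<open>xs\<close>; the quantifier over \<open>x\<close> then
        restores \<open>u x\<close>.\<close>
      show "\<forall>i. i \<notin> set xs \<longrightarrow> (u(x := v x)) i = v i" using u(1) by auto
      show "holds \<D> ((u(x := v x))(x := u x)) \<phi>" using u(2) by simp
    qed
  qed
  finally show ?case .
qed

lemma is_constraint_exs [simp]: "is_constraint \<Sigma> (exs xs \<phi>) = is_constraint \<Sigma> \<phi>"
  unfolding exs_def by (induction xs arbitrary: \<phi>) auto

lemma vars_exs [simp]: "vars_fm (exs xs \<phi>) = set xs \<union> vars_fm \<phi>"
  unfolding exs_def by (induction xs arbitrary: \<phi>) auto

definition conjs :: "('a \<Rightarrow> ('f, 'c) fm) \<Rightarrow> 'a list \<Rightarrow> ('f, 'c) fm" where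
  "conjs F xs = fold (\<lambda>x \<phi>. Conj (F x) \<phi>) xs TT"

lemma holds_conjs [simp]: "holds \<D> v (conjs F xs) \<longleftrightarrow> (\<forall>x\<in>set xs. holds \<D> v (F x))"
proof -
  have "holds \<D> v (fold (\<lambda>x \<phi>. Conj (F x) \<phi>) xs \<psi>) \<longleftrightarrow> (\<forall>x\<in>set xs. holds \<D> v (F x)) \<and> holds \<D> v \<psi>"
    for \<psi> by (induction xs arbitrary: \<psi>) auto
  then show ?thesis by (simp add: conjs_def)
qed

lemma is_constraint_conjs [simp]:
  "is_constraint \<Sigma> (conjs F xs) \<longleftrightarrow> (\<forall>x\<in>set xs. is_constraint \<Sigma> (F x))"
proof -
  have "is_constraint \<Sigma> (fold (\<lambda>x \<phi>. Conj (F x) \<phi>) xs \<psi>)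
      \<longleftrightarrow> (\<forall>x\<in>set xs. is_constraint \<Sigma> (F x)) \<and> is_constraint \<Sigma> \<psi>"
    for \<psi> by (induction xs arbitrary: \<psi>) auto
  then show ?thesis by (simp add: conjs_def)
qed

lemma vars_conjs [simp]: "vars_fm (conjs F xs) = (\<Union>x\<in>set xs. vars_fm (F x))"
proof -
  have "vars_fm (fold (\<lambda>x \<phi>. Conj (F x) \<phi>) xs \<psi>) = (\<Union>x\<in>set xs. vars_fm (F x)) \<union> vars_fm \<psi>"
    for \<psi> by (induction xs arbitrary: \<psi>) auto
  then show ?thesis by (simp add: conjs_def)
qed

lemma holds_term_eqs:
  assumes "is_structure \<Sigma> \<D>" "length ss = length ts"
  shows "holds \<D> v (term_eqs \<Sigma> ss ts) \<longleftrightarrow> map (eval \<D> v) ss = map (eval \<D> v) ts"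
  using assms(2,1) by (induction ss ts rule: list_induct2) (auto simp: term_eqs_def is_structure_def)

lemma is_constraint_term_eqs:
  assumes "is_signature \<Sigma>" "length ss = length ts"
    "\<forall>s\<in>set ss. is_term \<Sigma> s" "\<forall>t\<in>set ts. is_term \<Sigma> t"
  shows "is_constraint \<Sigma> (term_eqs \<Sigma> ss ts)"
  using assms(2,1,3,4) by (induction ss ts rule: list_induct2) (auto simp: term_eqs_def is_signature_def)

lemma vars_term_eqs:
  assumes "length ss = length ts"
  shows "vars_fm (term_eqs \<Sigma> ss ts) = (\<Union>s\<in>set ss. vars_trm s) \<union> (\<Union>t\<in>set ts. vars_trm t)"
  using assms by (induction ss ts rule: list_induct2) (auto simp: term_eqs_def)

section \<open>Solutions of constraint atoms\<close>

fun pred_of :: "('f, 'c, 'p) catom \<Rightarrow> 'p" where "pred_of (CAtom c p ss) = p"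
fun args_of :: "('f, 'c, 'p) catom \<Rightarrow> 'f trm list" where "args_of (CAtom c p ss) = ss"

definition solutions :: "('f, 'c, 'd) fo_structure \<Rightarrow> ('f, 'c, 'p) catom \<Rightarrow> 'd list set" where
  "solutions \<D> H = {map (eval \<D> v) (args_of H) | v. holds \<D> v (constr_of H)}"

lemma unify_imp_pred: "unify \<Sigma> \<D> C H \<Longrightarrow> pred_of C = pred_of H"
  by (cases C; cases H) (auto simp: unify_def satisfiable_def split: if_splits)

lemma unify_iff_solutions:
  assumes \<D>: "is_structure \<Sigma> \<D>" and dis: "var_disjoint C H"
    and p: "pred_of C = pred_of H" and len: "length (args_of C) = length (args_of H)"
  shows "unify \<Sigma> \<D> C H \<longleftrightarrow> solutions \<D> C \<inter> solutions \<D> H \<noteq> {}"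
proof -
  obtain c q ss where C: "C = CAtom c q ss" by (cases C)
  obtain e ts where H: "H = CAtom e q ts" using p C by (cases H) auto
  have "unify \<Sigma> \<D> C H \<longleftrightarrow> (\<exists>v. map (eval \<D> v) ss = map (eval \<D> v) ts \<and> holds \<D> v c \<and> holds \<D> v e)"
    using len C H by (simp add: unify_def satisfiable_def holds_term_eqs[OF \<D>])
  also have "\<dots> \<longleftrightarrow> solutions \<D> C \<inter> solutions \<D> H \<noteq> {}"
  proof
    assume "\<exists>v. map (eval \<D> v) ss = map (eval \<D> v) ts \<and> holds \<D> v c \<and> holds \<D> v e"
    then show "solutions \<D> C \<inter> solutions \<D> H \<noteq> {}" using C H unfolding solutions_def by auto
  next
    assume "solutions \<D> C \<inter> solutions \<D> H \<noteq> {}"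
    then obtain v w where vw: "map (eval \<D> v) ss = map (eval \<D> w) ts" "holds \<D> v c" "holds \<D> w e"
      using C H unfolding solutions_def by auto
    \<comment> \<open>Two valuations are glued: \<open>u\<close> follows \<open>v\<close> on the
      variables of \<open>C\<close> and \<open>w\<close> elsewhere, hence by disjointness on all
      variables of \<open>H\<close>.\<close>
    define u where "u x = (if x \<in> vars_catom C then v x else w x)" for x
    have "map (eval \<D> u) ss = map (eval \<D> v) ss" "holds \<D> u c = holds \<D> v c"
      using C by (intro map_eval_cong holds_cong; force simp: u_def)+
    moreover have "map (eval \<D> u) ts = map (eval \<D> w) ts" "holds \<D> u e = holds \<D> w e"
      using C H dis by (intro map_eval_cong holds_cong; force simp: u_def var_disjoint_def)+
    ultimately show "\<exists>v. map (eval \<D> v) ss = map (eval \<D> v) ts \<and> holds \<D> v c \<and> holds \<D> v e"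
      using vw by (intro exI[of _ u]) (simp only:)
  qed
  finally show ?thesis .
qed

text \<open>The variables of \<open>H\<close> are shifted by \<open>B\<close>: \<open>d\<close> must not share even bound
  variables with \<open>H\<close>.\<close>

definition exclude :: "('f, 'c) fo_signature \<Rightarrow> nat \<Rightarrow> 'f trm list \<Rightarrow> ('f, 'c, 'p) catom \<Rightarrow> ('f, 'c) fm" where
  "exclude \<Sigma> B ss H = Neg (exs [B..<2*B] (Conj (term_eqs \<Sigma> ss (map (rename_trm (\<lambda>x. x + B)) (args_of H)))
     (rename_fm (\<lambda>x. x + B) (constr_of H))))"

text \<open>The terms \<open>ss\<close> live below \<open>B\<close> and the shifted copy of
  \<open>H\<close> lives in \<open>[B..<2*B]\<close>. The quantifier block therefore ranges over all
  valuations of the copy and leaves the values of \<open>ss\<close> fixed.\<close>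

lemma holds_exclude:
  assumes \<D>: "is_structure \<Sigma> \<D>" and len: "length ss = length (args_of H)"
    and ss: "\<forall>s\<in>set ss. vars_trm s \<subseteq> {..<B}" and H: "vars_catom H \<subseteq> {..<B}"
  shows "holds \<D> v (exclude \<Sigma> B ss H) \<longleftrightarrow> map (eval \<D> v) ss \<notin> solutions \<D> H"
proof -
  obtain e q ts where Heq: "H = CAtom e q ts" by (cases H)
  let ?\<rho> = "\<lambda>x::nat. x + B"
  have inj: "inj ?\<rho>" by (simp add: inj_def)
  have body: "holds \<D> w (Conj (term_eqs \<Sigma> ss (map (rename_trm ?\<rho>) ts)) (rename_fm ?\<rho> e))
      \<longleftrightarrow> map (eval \<D> w) ss = map (eval \<D> (w \<circ> ?\<rho>)) ts \<and> holds \<D> (w \<circ> ?\<rho>) e" for w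
    using len Heq by (simp add: holds_term_eqs[OF \<D>] holds_rename[OF inj] eval_rename comp_def)
  have "(\<exists>w. (\<forall>i. i \<notin> set [B..<2*B] \<longrightarrow> w i = v i) \<and>
      map (eval \<D> w) ss = map (eval \<D> (w \<circ> ?\<rho>)) ts \<and> holds \<D> (w \<circ> ?\<rho>) e)
      \<longleftrightarrow> map (eval \<D> v) ss \<in> solutions \<D> H" (is "?L \<longleftrightarrow> ?R")
  proof
    assume ?L
    then obtain w where w: "\<And>i. i \<notin> set [B..<2*B] \<Longrightarrow> w i = v i"
      "map (eval \<D> w) ss = map (eval \<D> (w \<circ> ?\<rho>)) ts" "holds \<D> (w \<circ> ?\<rho>) e" by blast
    have "map (eval \<D> v) ss = map (eval \<D> w) ss"
      using ss w(1) by (intro map_eval_cong) fastforce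
    then show ?R using w(2,3) Heq by (auto simp: solutions_def)
  next
    assume ?R
    then obtain u where u: "map (eval \<D> v) ss = map (eval \<D> u) ts" "holds \<D> u e"
      using Heq by (auto simp: solutions_def)
    \<comment> \<open>This transports \<open>u\<close> to the shifted copy:
      \<open>w (x + B) = u x\<close> for \<open>x < B\<close>.\<close>
    define w where "w i = (if B \<le> i \<and> i < 2*B then u (i - B) else v i)" for i
    have "map (eval \<D> w) ss = map (eval \<D> v) ss"
      using ss by (intro map_eval_cong) (fastforce simp: w_def)
    moreover have "map (eval \<D> (w \<circ> ?\<rho>)) ts = map (eval \<D> u) ts" "holds \<D> (w \<circ> ?\<rho>) e = holds \<D> u e"
      using H Heq by (intro map_eval_cong holds_cong; force simp: w_def)+
    ultimately show ?L using u by (intro exI[of _ w]) (auto simp: w_def)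
  qed
  then show ?thesis using Heq body unfolding exclude_def by (simp add: holds_exs del: set_upt)
qed

lemma is_constraint_exclude:
  assumes "is_signature \<Sigma>" "length ss = length (args_of H)"
    "\<forall>s\<in>set ss. is_term \<Sigma> s" "is_catom \<Sigma> PP ar H"
  shows "is_constraint \<Sigma> (exclude \<Sigma> B ss H)"
  using assms by (cases H)
    (auto simp: exclude_def is_term_rename intro!: is_constraint_rename is_constraint_term_eqs)

lemma vars_exclude:
  assumes "length ss = length (args_of H)"
  shows "vars_fm (exclude \<Sigma> B ss H) \<subseteq> (\<Union>s\<in>set ss. vars_trm s) \<union> {B..}"
  using assms by (auto simp: exclude_def vars_term_eqs vars_rename_trm vars_rename_fm)

lemma csu_instanceD:
  assumes "csu_instance \<Sigma> \<D> PP ar C Hpos Hneg" "H \<in> Hpos \<union> Hneg"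
  shows "is_catom \<Sigma> PP ar H" "var_disjoint C H" "pred_of C = pred_of H"
    "length (args_of C) = length (args_of H)"
proof -
  show "is_catom \<Sigma> PP ar H" "var_disjoint C H" and p: "pred_of C = pred_of H"
    using assms unify_imp_pred unfolding csu_instance_def by blast+
  moreover have "is_catom \<Sigma> PP ar C" using assms unfolding csu_instance_def by blast
  ultimately show "length (args_of C) = length (args_of H)" by (cases C; cases H) auto
qed

text \<open>The case \<open>H = C\<close> on the right says that the difference is nonempty, which
  accounts for the satisfiability of the narrowed constraint even if there are no positive atoms. An
  arbitrary admissible \<open>d\<close> only yields a subset of the difference; the \<open>d\<close>
  built from \<open>exclude\<close> attains all of it.\<close>

lemma selective_nonempty_iff:
  assumes \<Sigma>: "is_signature \<Sigma>" and \<D>: "is_structure \<Sigma> \<D>"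
    and inst: "csu_instance \<Sigma> \<D> PP ar C (set hpos) (set hneg)"
    and bound: "\<forall>H\<in>insert C (set hpos \<union> set hneg). vars_catom H \<subseteq> {..<B}"
  shows "selective \<Sigma> \<D> C (set hpos) (set hneg) \<noteq> {} \<longleftrightarrow>
    (\<forall>H\<in>insert C (set hpos). solutions \<D> H \<inter> solutions \<D> C - (\<Union>H'\<in>set hneg. solutions \<D> H') \<noteq> {})"
    (is "?L \<longleftrightarrow> ?R")
proof -
  obtain c p ss where C: "C = CAtom c p ss" by (cases C)
  note D = csu_instanceD[OF inst]
  have unify: "unify \<Sigma> \<D> (and_constr C d) H \<longleftrightarrow> solutions \<D> (and_constr C d) \<inter> solutions \<D> H \<noteq> {}"
    if "H \<in> set hpos \<union> set hneg" "var_disjoint (and_constr C d) H" for d H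
    using D(3,4)[OF that(1)] C that(2) by (intro unify_iff_solutions[OF \<D>]) auto
  show ?thesis
  proof
    assume ?L
    then obtain d where d: "satisfiable \<D> (Conj c d)"
      "\<forall>H \<in> set hpos \<union> set hneg. var_disjoint (and_constr C d) H"
      "\<forall>H \<in> set hpos. unify \<Sigma> \<D> (and_constr C d) H"
      "\<forall>H \<in> set hneg. \<not> unify \<Sigma> \<D> (and_constr C d) H"
      unfolding selective_def C by auto
    let ?A = "solutions \<D> (and_constr C d)"
    have "?A \<subseteq> solutions \<D> C" by (auto simp: C solutions_def)
    moreover have "?A \<noteq> {}" using d(1) by (auto simp: C solutions_def satisfiable_def)
    moreover have "?A \<inter> solutions \<D> H \<noteq> {}" if "H \<in> set hpos" for H
      using d(2,3) unify that by blast
    moreover have "?A \<inter> solutions \<D> H = {}" if "H \<in> set hneg" for H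
      using d(2,4) unify that by blast
    ultimately show ?R by blast
  next
    assume R: ?R
    define d where "d = conjs (exclude \<Sigma> B ss) hneg"
    have cat: "is_catom \<Sigma> PP ar C" using inst unfolding csu_instance_def by blast
    have ss: "\<forall>s\<in>set ss. vars_trm s \<subseteq> {..<B}" using bound C by auto
    have len: "length ss = length (args_of H)" if "H \<in> set hneg" for H
      using D(4)[of H] that C by auto
    have holds_d: "holds \<D> v d \<longleftrightarrow> (\<forall>H\<in>set hneg. map (eval \<D> v) ss \<notin> solutions \<D> H)" for v
      using bound by (simp add: d_def holds_exclude[OF \<D> len ss])
    have sol: "solutions \<D> (and_constr C d) = solutions \<D> C - (\<Union>H'\<in>set hneg. solutions \<D> H')"
      by (auto simp: C solutions_def[of _ "CAtom _ _ _"] holds_d)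
    have con: "is_constraint \<Sigma> d"
      using cat C D(1) by (auto simp: d_def intro!: is_constraint_exclude[OF \<Sigma> len])
    \<comment> \<open>A variable of \<open>d\<close> either occurs in \<open>C\<close>, which is
      disjoint from the other atoms, or is at least \<open>B\<close>, above all of their
      variables.\<close>
    have vars: "vars_fm d \<subseteq> vars_catom C \<union> {B..}"
      using vars_exclude[OF len] C by (fastforce simp: d_def)
    have disj: "var_disjoint (and_constr C d) H" if H: "H \<in> set hpos \<union> set hneg" for H
    proof -
      have "vars_catom (and_constr C d) = vars_catom C \<union> vars_fm d" by (auto simp: C)
      then show ?thesis using D(2)[OF H] vars bound H unfolding var_disjoint_def by fastforce
    qed
    have "solutions \<D> (and_constr C d) \<noteq> {}" using R sol by auto
    then have "satisfiable \<D> (constr_of (and_constr C d))"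
      by (auto simp: solutions_def satisfiable_def)
    moreover have "unify \<Sigma> \<D> (and_constr C d) H" if "H \<in> set hpos" for H
    proof -
      have "solutions \<D> H \<inter> solutions \<D> C - (\<Union>H'\<in>set hneg. solutions \<D> H') \<noteq> {}" using R that by blast
      then show ?thesis using unify[OF _ disj] that sol by blast
    qed
    moreover have "\<not> unify \<Sigma> \<D> (and_constr C d) H" if "H \<in> set hneg" for H
      using unify[OF _ disj] that sol by blast
    ultimately have "and_constr C d \<in> selective \<Sigma> \<D> C (set hpos) (set hneg)"
      using con disj unfolding selective_def by blast
    then show ?L by blast
  qed
qed

section \<open>The decision formula\<close>

text \<open>A running variable index replaces a second list as in \<open>term_eqs\<close>, so that a
  single fold over the coded terms computes the code of this formula.\<close>

definition var_eqs :: "'c \<Rightarrow> nat \<Rightarrow> 'f trm list \<Rightarrow> ('f, 'c) fm" where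
  "var_eqs q B ts = snd (fold (\<lambda>t (b, \<phi>). (Suc b, Conj (Atom q [Var b, t]) \<phi>)) ts (B, TT))"

text \<open>If \<open>B\<close> exceeds all variables of \<open>H\<close>, the block binds them all,
  and only the variables from \<open>B\<close> on, which hold the candidate tuple, remain free.
  Several such formulas can thus talk about the same tuple.\<close>

definition member_fm :: "'c \<Rightarrow> nat \<Rightarrow> ('f, 'c, 'p) catom \<Rightarrow> ('f, 'c) fm" where
  "member_fm q B H = exs [0..<B] (Conj (var_eqs q B (args_of H)) (constr_of H))"

text \<open>Each conjunct has its own quantifier block, since different positive atoms may be met by
  different tuples. A tuple of length at most \<open>B\<close> fits into the variables from
  \<open>B\<close> to \<open>B+B-1\<close>, so the block binds it entirely.\<close>

definition decision_fm :: "'c \<Rightarrow> nat \<Rightarrow> ('f, 'c, 'p) catom \<Rightarrow> ('f, 'c, 'p) catom list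
    \<Rightarrow> ('f, 'c, 'p) catom list \<Rightarrow> ('f, 'c) fm" where
  "decision_fm q B C hpos hneg =
     conjs (\<lambda>H. exs [0..<B+B] (Conj (member_fm q B H)
       (Conj (member_fm q B C) (conjs (\<lambda>H'. Neg (member_fm q B H')) hneg)))) (C # hpos)"

lemma holds_var_eqs:
  assumes "is_structure \<Sigma> \<D>"
  shows "holds \<D> v (var_eqs (eq_sym \<Sigma>) B ts) \<longleftrightarrow> map v [B..<B + length ts] = map (eval \<D> v) ts"
proof -
  have "holds \<D> v (snd (fold (\<lambda>t (b, \<phi>). (Suc b, Conj (Atom (eq_sym \<Sigma>) [Var b, t]) \<phi>)) ts (B, \<psi>)))
      \<longleftrightarrow> map v [B..<B + length ts] = map (eval \<D> v) ts \<and> holds \<D> v \<psi>" for \<psi>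
  proof (induction ts arbitrary: B \<psi>)
    case (Cons t ts)
    have "[B..<B + length (t # ts)] = B # [Suc B..<Suc B + length ts]"
      using upt_conv_Cons[of B "B + length (t # ts)"] by (simp del: upt_Suc)
    then show ?case using assms by (auto simp: Cons.IH is_structure_def simp del: upt_Suc)
  qed simp
  then show ?thesis by (simp add: var_eqs_def)
qed

lemma is_constraint_var_eqs:
  assumes "is_signature \<Sigma>" "\<forall>t\<in>set ts. is_term \<Sigma> t"
  shows "is_constraint \<Sigma> (var_eqs (eq_sym \<Sigma>) B ts)"
proof -
  have "is_constraint \<Sigma> \<psi> \<Longrightarrow>
      is_constraint \<Sigma> (snd (fold (\<lambda>t (b, \<phi>). (Suc b, Conj (Atom (eq_sym \<Sigma>) [Var b, t]) \<phi>)) ts (B, \<psi>)))" for \<psi>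
    using assms(2)
  proof (induction ts arbitrary: B \<psi>)
    case (Cons t ts)
    then show ?case using assms(1) by (simp add: is_signature_def)
  qed simp
  then show ?thesis by (simp add: var_eqs_def)
qed

lemma holds_member_fm:
  assumes \<D>: "is_structure \<Sigma> \<D>" and H: "vars_catom H \<subseteq> {..<B}"
  shows "holds \<D> v (member_fm (eq_sym \<Sigma>) B H)
    \<longleftrightarrow> map v [B..<B + length (args_of H)] \<in> solutions \<D> H" (is "?L \<longleftrightarrow> ?R")
proof -
  obtain e q ts where Heq: "H = CAtom e q ts" by (cases H)
  have L: "?L \<longleftrightarrow> (\<exists>w. (\<forall>i. i \<notin> set [0..<B] \<longrightarrow> w i = v i) \<and>
      map w [B..<B + length ts] = map (eval \<D> w) ts \<and> holds \<D> w e)"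
    by (simp add: member_fm_def holds_exs holds_var_eqs[OF \<D>] Heq)
  show ?thesis
  proof
    assume ?L
    then obtain w where w: "\<And>i. i \<notin> set [0..<B] \<Longrightarrow> w i = v i"
      "map w [B..<B + length ts] = map (eval \<D> w) ts" "holds \<D> w e" unfolding L by blast
    have "map v [B..<B + length ts] = map w [B..<B + length ts]" by (auto simp: w(1))
    then show ?R using w(2,3) by (auto simp: Heq solutions_def)
  next
    assume ?R
    then obtain u where u: "map v [B..<B + length ts] = map (eval \<D> u) ts" "holds \<D> u e"
      by (auto simp: Heq solutions_def)
    \<comment> \<open>Below \<open>B\<close>, where the block binds, \<open>w\<close> takes the
      witness \<open>u\<close>; from \<open>B\<close> on it keeps \<open>v\<close> and with it the
      tuple.\<close>
    define w where "w i = (if i < B then u i else v i)" for i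
    have "map (eval \<D> w) ts = map (eval \<D> u) ts" "holds \<D> w e = holds \<D> u e"
      using H Heq by (intro map_eval_cong holds_cong; force simp: w_def)+
    moreover have "map w [B..<B + length ts] = map v [B..<B + length ts]" by (auto simp: w_def)
    ultimately show ?L unfolding L using u by (intro exI[of _ w]) (auto simp: w_def)
  qed
qed

lemma satisfiable_decision_fm:
  assumes \<D>: "is_structure \<Sigma> \<D>"
    and bound: "\<forall>H\<in>insert C (set hpos \<union> set hneg). vars_catom H \<subseteq> {..<B}"
    and len: "\<forall>H\<in>set hpos \<union> set hneg. length (args_of C) = length (args_of H)"
    and B: "length (args_of C) \<le> B"
  shows "satisfiable \<D> (decision_fm (eq_sym \<Sigma>) B C hpos hneg) \<longleftrightarrow>
    (\<forall>H\<in>insert C (set hpos). solutions \<D> H \<inter> solutions \<D> C - (\<Union>H'\<in>set hneg. solutions \<D> H') \<noteq> {})"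
proof -
  let ?k = "length (args_of C)"
  let ?\<phi> = "\<lambda>H. Conj (member_fm (eq_sym \<Sigma>) B H)
       (Conj (member_fm (eq_sym \<Sigma>) B C) (conjs (\<lambda>H'. Neg (member_fm (eq_sym \<Sigma>) B H')) hneg))"
  \<comment> \<open>The right-hand side does not mention \<open>v\<close>, so satisfiability of the
    conjunction splits into separate conditions for the atoms \<open>H\<close>.\<close>
  have "holds \<D> v (exs [0..<B+B] (?\<phi> H)) \<longleftrightarrow>
      solutions \<D> H \<inter> solutions \<D> C - (\<Union>H'\<in>set hneg. solutions \<D> H') \<noteq> {}"
    if H: "H \<in> insert C (set hpos)" for H v
  proof -
    let ?A = "solutions \<D> H \<inter> solutions \<D> C - (\<Union>H'\<in>set hneg. solutions \<D> H')"
    have member: "holds \<D> w (member_fm (eq_sym \<Sigma>) B H') \<longleftrightarrow> map w [B..<B + ?k] \<in> solutions \<D> H'"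
      if "H' \<in> insert C (set hpos \<union> set hneg)" for w H'
    proof -
      have "length (args_of H') = ?k" using len that by (metis insert_iff)
      moreover have "vars_catom H' \<subseteq> {..<B}" using bound that by blast
      ultimately show ?thesis using holds_member_fm[OF \<D>, of H' B w] by simp
    qed
    have \<phi>: "holds \<D> w (?\<phi> H) \<longleftrightarrow> map w [B..<B + ?k] \<in> ?A" for w
      using H by (auto simp: member)
    show ?thesis
    proof
      assume "holds \<D> v (exs [0..<B+B] (?\<phi> H))"
      then obtain w where "holds \<D> w (?\<phi> H)" unfolding holds_exs by blast
      then show "?A \<noteq> {}" using \<phi> by blast
    next
      assume "?A \<noteq> {}"
      then obtain a where a: "a \<in> ?A" by blast
      then have "length a = ?k" by (auto simp: solutions_def)
      \<comment> \<open>The tuple \<open>a\<close> is written into the variables from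
        \<open>B\<close> on.\<close>
      define w where "w i = (if B \<le> i \<and> i < B + ?k then a ! (i - B) else v i)" for i
      have "map w [B..<B + ?k] = a"
        using \<open>length a = ?k\<close> by (intro nth_equalityI) (auto simp: w_def)
      then have "holds \<D> w (?\<phi> H)" using \<phi> a by simp
      moreover have "\<forall>i. i \<notin> set [0..<B+B] \<longrightarrow> w i = v i" using B by (auto simp: w_def)
      ultimately show "holds \<D> v (exs [0..<B+B] (?\<phi> H))" unfolding holds_exs by blast
    qed
  qed
  then show ?thesis unfolding satisfiable_def decision_fm_def by (simp del: holds.simps)
qed

lemma is_constraint_decision_fm:
  assumes "is_signature \<Sigma>" "\<forall>H\<in>insert C (set hpos \<union> set hneg). is_catom \<Sigma> PP ar H"
  shows "is_constraint \<Sigma> (decision_fm (eq_sym \<Sigma>) B C hpos hneg)"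
proof -
  have "is_constraint \<Sigma> (member_fm (eq_sym \<Sigma>) B H)" if "is_catom \<Sigma> PP ar H" for H
    using that by (cases H) (auto simp: member_fm_def is_constraint_var_eqs[OF assms(1)])
  then show ?thesis using assms(2) by (auto simp: decision_fm_def)
qed

section \<open>Computing the code of the decision formula\<close>

text \<open>Pair and list codes are at least as large as their components. Following this up to the
  whole input bounds every variable by the input code, which makes its successor a valid
  \<open>B\<close>.\<close>

lemma vars_trm_le_enc: "x \<in> vars_trm t \<Longrightarrow> x \<le> enc_trm nf t"
proof (induction t)
  case (Var y)
  then show ?case by (simp add: le_prod_encode_2)
next
  case (Fn f ts)
  then obtain t where "t \<in> set ts" "x \<le> enc_trm nf t" by auto
  then have "x \<le> list_encode (map (enc_trm nf) ts)"
    using member_le_list_encode[of "enc_trm nf t" "map (enc_trm nf) ts"] by simp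
  then show ?case by (auto intro: le_trans[OF _ le_prod_encode_2])
qed

lemma vars_trms_le_enc: "t \<in> set ts \<Longrightarrow> x \<in> vars_trm t \<Longrightarrow> x \<le> list_encode (map (enc_trm nf) ts)"
  using member_le_list_encode[of "enc_trm nf t" "map (enc_trm nf) ts"] vars_trm_le_enc[of x t nf]
  by simp

lemma vars_fm_le_enc: "x \<in> vars_fm \<phi> \<Longrightarrow> x \<le> enc_fm nf nc \<phi>"
  by (induction \<phi>) (auto intro: le_trans[OF _ le_prod_encode_2] le_trans[OF _ le_prod_encode_1]
      le_prod_encode_1 dest: vars_trms_le_enc[of _ _ _ nf])

lemma vars_catom_le_enc: "x \<in> vars_catom H \<Longrightarrow> x \<le> enc_catom nf nc np H"
  by (cases H) (auto intro: le_trans[OF _ le_prod_encode_2] le_trans[OF _ le_prod_encode_1]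
      dest: vars_trms_le_enc[of _ _ _ nf] vars_fm_le_enc[of _ _ nf nc])

lemma length_args_le_enc: "length (args_of H) \<le> enc_catom nf nc np H"
proof (cases H)
  case (CAtom c p ss)
  then show ?thesis using length_le_list_encode[of "map (enc_trm nf) ss"]
    by (auto intro: le_trans[OF _ le_prod_encode_2])
qed

lemma enc_catom_le_enc_input:
  "H \<in> insert C (set hpos \<union> set hneg) \<Longrightarrow> enc_catom nf nc np H \<le> enc_input nf nc np (C, hpos, hneg)"
proof -
  have "enc_catom nf nc np H \<le> list_encode (map (enc_catom nf nc np) Hs)" if "H \<in> set Hs" for Hs
    using that by (intro member_le_list_encode) auto
  then show "H \<in> insert C (set hpos \<union> set hneg) \<Longrightarrow> ?thesis"
    by (auto intro: le_prod_encode_1 le_trans[OF _ le_prod_encode_2] le_trans[OF _ le_prod_encode_1])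
qed

section \<open>Formula constructions carried out on codes\<close>

definition exs_code :: "nat \<Rightarrow> nat \<Rightarrow> nat" where
  "exs_code n c = psnd (((\<lambda>s. prod_encode (Suc (pfst s), prod_encode (7, s))) ^^ n) (prod_encode (0, c)))"

text \<open>A state (n, code) is already what the tag 7 of \<open>Ex n\<close> expects, so one step
  tags the state and increments the index. Since \<open>exs\<close> is a left fold, the last
  variable is outermost, in the order of the iteration.\<close>

lemma exs_code: "exs_code n (enc_fm nf nc \<phi>) = enc_fm nf nc (exs [0..<n] \<phi>)"
proof -
  have "((\<lambda>s. prod_encode (Suc (pfst s), prod_encode (7, s))) ^^ n) (prod_encode (0, enc_fm nf nc \<phi>))
      = prod_encode (n, enc_fm nf nc (exs [0..<n] \<phi>))"
    by (induction n) (auto simp: exs_def)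
  then show ?thesis by (simp add: exs_code_def)
qed

lemma computable_exs_code:
  "computable f \<Longrightarrow> computable g \<Longrightarrow> computable (\<lambda>x. exs_code (f x) (g x))"
  unfolding exs_code_def by (intro computable_intros computable_funpow)

definition conj_code :: "nat \<Rightarrow> nat \<Rightarrow> nat" where
  "conj_code a b = prod_encode (4, prod_encode (a, b))"

lemma computable_conj_code:
  "computable f \<Longrightarrow> computable g \<Longrightarrow> computable (\<lambda>x. conj_code (f x) (g x))"
  unfolding conj_code_def by (intro computable_intros)

text \<open>The accumulator is hidden from \<open>f\<close>, which sees only element and parameter;
  the start value is the code of \<open>TT\<close>.\<close>

definition conjs_code :: "(nat \<Rightarrow> nat) \<Rightarrow> nat \<Rightarrow> nat \<Rightarrow> nat" where
  "conjs_code f p l =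
     fold_code (\<lambda>s. conj_code (f (prod_encode (pfst s, pfst (psnd s)))) (psnd (psnd s))) p l (prod_encode (0, 0))"

lemma computable_conjs_code:
  assumes "computable f" "computable p" "computable l"
  shows "computable (\<lambda>x. conjs_code f (p x) (l x))"
  unfolding conjs_code_def
  by (intro computable_fold_code computable_conj_code computable_comp[OF assms(1)] computable_intros
      assms(2,3))

lemma conjs_code:
  assumes "\<And>H. f (prod_encode (enc H, p)) = enc_fm nf nc (F H)"
  shows "conjs_code f p (list_encode (map enc Hs)) = enc_fm nf nc (conjs F Hs)"
proof -
  have "fold (\<lambda>h acc. conj_code (f (prod_encode (h, p))) acc) (map enc Hs) (enc_fm nf nc \<psi>)
      = enc_fm nf nc (fold (\<lambda>x \<phi>. Conj (F x) \<phi>) Hs \<psi>)" for \<psi>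
  proof (induction Hs arbitrary: \<psi>)
    case (Cons H Hs)
    show ?case using Cons.IH[of "Conj (F H) \<psi>"] by (simp add: assms conj_code_def)
  qed simp
  from this[of TT] show ?thesis by (simp add: conjs_code_def fold_code_def conjs_def)
qed

text \<open>The accumulator is the pair of next variable index and formula code. The nested
  successors spell out the list code of \<open>[Var b, t]\<close>. The symbol code \<open>q\<close>
  is fixed with the signature, so the parameter slot just holds 0.\<close>

definition var_eqs_code :: "nat \<Rightarrow> nat \<Rightarrow> nat \<Rightarrow> nat" where
  "var_eqs_code q B l = psnd (fold_code (\<lambda>s. prod_encode (Suc (pfst (psnd (psnd s))),
     conj_code (prod_encode (2, prod_encode (q,
         Suc (prod_encode (prod_encode (0, pfst (psnd (psnd s))), Suc (prod_encode (pfst s, 0)))))))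
       (psnd (psnd (psnd s))))) 0 l (prod_encode (B, prod_encode (0, 0))))"

lemma computable_var_eqs_code:
  "computable f \<Longrightarrow> computable g \<Longrightarrow> computable (\<lambda>x. var_eqs_code q (f x) (g x))"
  unfolding var_eqs_code_def
  by (intro computable_fold_code computable_conj_code computable_intros)

lemma var_eqs_code:
  "var_eqs_code (nc q) B (list_encode (map (enc_trm nf) ts)) = enc_fm nf nc (var_eqs q B ts)"
proof -
  define enc where "enc = (\<lambda>(b, \<phi>). prod_encode (b, enc_fm nf nc \<phi>))"
  have "fold (\<lambda>h acc. prod_encode (Suc (pfst acc),
     conj_code (prod_encode (2, prod_encode (nc q,
         Suc (prod_encode (prod_encode (0, pfst acc), Suc (prod_encode (h, 0)))))))
       (psnd acc))) (map (enc_trm nf) ts) (enc s)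
     = enc (fold (\<lambda>t (b, \<phi>). (Suc b, Conj (Atom q [Var b, t]) \<phi>)) ts s)" for s
  proof (induction ts arbitrary: s)
    case (Cons t ts)
    obtain b \<phi> where s: "s = (b, \<phi>)" by fastforce
    show ?case using Cons.IH[of "(Suc b, Conj (Atom q [Var b, t]) \<phi>)"]
      by (simp add: s enc_def conj_code_def)
  qed simp
  from this[of "(B, TT)"] show ?thesis
    by (simp add: var_eqs_code_def fold_code_def var_eqs_def enc_def split_beta)
qed

definition member_code :: "nat \<Rightarrow> nat \<Rightarrow> nat \<Rightarrow> nat" where
  "member_code q B h = exs_code B (conj_code (var_eqs_code q B (psnd (psnd h))) (pfst h))"

lemma computable_member_code:
  "computable f \<Longrightarrow> computable g \<Longrightarrow> computable (\<lambda>x. member_code q (f x) (g x))"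
  unfolding member_code_def
  by (intro computable_exs_code computable_conj_code computable_var_eqs_code computable_intros)

lemma member_code: "member_code (nc q) B (enc_catom nf nc np H) = enc_fm nf nc (member_fm q B H)"
proof (cases H)
  case (CAtom c p ss)
  then show ?thesis
    using exs_code[of B nf nc "Conj (var_eqs q B ss) c"]
    by (simp add: member_code_def member_fm_def var_eqs_code conj_code_def)
qed

text \<open>This is the part common to all conjuncts. It is computed once and handed to the outer
  conjunction as a parameter, because the function folded there must not vary with the
  input.\<close>

definition core_code :: "nat \<Rightarrow> nat \<Rightarrow> nat \<Rightarrow> nat \<Rightarrow> nat" where
  "core_code q B c l = conj_code (member_code q B c)
     (conjs_code (\<lambda>s. prod_encode (3, member_code q (psnd s) (pfst s))) B l)"

lemma computable_core_code:
  "computable f \<Longrightarrow> computable g \<Longrightarrow> computable h \<Longrightarrow> computable (\<lambda>x. core_code q (f x) (g x) (h x))"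
  unfolding core_code_def
  by (intro computable_conj_code computable_conjs_code computable_member_code computable_intros)

lemma core_code:
  "core_code (nc q) B (enc_catom nf nc np C) (list_encode (map (enc_catom nf nc np) hneg))
    = enc_fm nf nc (Conj (member_fm q B C) (conjs (\<lambda>H'. Neg (member_fm q B H')) hneg))"
proof -
  have "conjs_code (\<lambda>s. prod_encode (3, member_code (nc q) (psnd s) (pfst s))) B
      (list_encode (map (enc_catom nf nc np) hneg))
      = enc_fm nf nc (conjs (\<lambda>H'. Neg (member_fm q B H')) hneg)"
    by (rule conjs_code) (simp add: member_code)
  then show ?thesis by (simp add: core_code_def member_code conj_code_def)
qed

text \<open>The bound \<open>B\<close> is \<open>Suc x\<close>, strictly above all variables of the
  input coded by \<open>x\<close>. The parameter pairs \<open>B\<close> with the common part, and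
  the last argument is the list code of \<open>C # hpos\<close>.\<close>

definition decision_code :: "nat \<Rightarrow> nat \<Rightarrow> nat" where
  "decision_code q x =
     conjs_code (\<lambda>s. exs_code (pfst (psnd s) + pfst (psnd s))
         (conj_code (member_code q (pfst (psnd s)) (pfst s)) (psnd (psnd s))))
       (prod_encode (Suc x, core_code q (Suc x) (pfst x) (psnd (psnd x))))
       (Suc (prod_encode (pfst x, pfst (psnd x))))"

lemma computable_decision_code: "computable (decision_code q)"
proof -
  have "computable (\<lambda>x. decision_code q x)"
    unfolding decision_code_def
    by (intro computable_conjs_code computable_exs_code computable_conj_code
        computable_member_code computable_core_code computable_intros)
  then show ?thesis .
qed

lemma decision_code:
  fixes hpos :: "('f, 'c, 'p) catom list"
  assumes x_def: "x = enc_input nf nc np (C, hpos, hneg)"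
  shows "decision_code (nc q) x = enc_fm nf nc (decision_fm q (Suc x) C hpos hneg)"
proof -
  let ?R = "Conj (member_fm q (Suc x) C) (conjs (\<lambda>H'. Neg (member_fm q (Suc x) H')) hneg)"
  have proj: "pfst x = enc_catom nf nc np C" "pfst (psnd x) = list_encode (map (enc_catom nf nc np) hpos)"
    "psnd (psnd x) = list_encode (map (enc_catom nf nc np) hneg)"
    by (simp_all add: x_def)
  have "exs_code (Suc x + Suc x) (conj_code (member_code (nc q) (Suc x) (enc_catom nf nc np H)) (enc_fm nf nc ?R))
      = enc_fm nf nc (exs [0..<Suc x + Suc x] (Conj (member_fm q (Suc x) H) ?R))"
    for H :: "('f, 'c, 'p) catom"
    using exs_code[of "Suc x + Suc x" nf nc "Conj (member_fm q (Suc x) H) ?R"]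
    by (simp add: member_code conj_code_def del: upt_Suc)
  then have "conjs_code (\<lambda>s. exs_code (pfst (psnd s) + pfst (psnd s))
         (conj_code (member_code (nc q) (pfst (psnd s)) (pfst s)) (psnd (psnd s))))
       (prod_encode (Suc x, enc_fm nf nc ?R)) (list_encode (map (enc_catom nf nc np) (C # hpos)))
     = enc_fm nf nc (decision_fm q (Suc x) C hpos hneg)"
    unfolding decision_fm_def by (intro conjs_code) simp
  then show ?thesis
    unfolding decision_code_def proj core_code by simp
qed

section \<open>The decision procedure, relative to the solver\<close>

theorem corollary1:
  fixes \<Sigma> :: "('f, 'c) fo_signature"
    and \<D> :: "('f, 'c, 'd) fo_structure"
    and PP :: "'p set" and ar :: "'p \<Rightarrow> nat"
    and nf :: "'f \<Rightarrow> nat" and nc :: "'c \<Rightarrow> nat" and np :: "'p \<Rightarrow> nat"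
  assumes "is_signature \<Sigma>" and "is_structure \<Sigma> \<D>"
    and "inj_on nf (funs \<Sigma>)" and "inj_on nc (cpreds \<Sigma>)" and "inj_on np PP"
    and solver: "decidable_on (enc_fm nf nc) {\<phi>. is_constraint \<Sigma> \<phi>} (satisfiable \<D>)"
  shows "decidable_on (enc_input nf nc np)
           {(C, hpos, hneg). csu_instance \<Sigma> \<D> PP ar C (set hpos) (set hneg)}
           (\<lambda>(C, hpos, hneg). selective \<Sigma> \<D> C (set hpos) (set hneg) = {})"
proof -
  obtain solve where solve:
    "\<And>\<phi>. is_constraint \<Sigma> \<phi> \<Longrightarrow> rec_eval solve [enc_fm nf nc \<phi>] (if satisfiable \<D> \<phi> then 1 else 0)"
    using solver unfolding decidable_on_def by blast
  obtain build where build: "\<And>x. rec_eval build [x] (decision_code (nc (eq_sym \<Sigma>)) x)"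
    using computable_decision_code unfolding computable_def by blast
  \<comment> \<open>The decision formula expresses nonemptiness while the question is emptiness, so
    the solver's answer has to be flipped.\<close>
  have "computable (\<lambda>x. if x = 0 then 1 else 0)"
    by (intro computable_If computable_intros)
  then obtain neg where neg: "\<And>x. rec_eval neg [x] (if x = 0 then 1 else 0)"
    unfolding computable_def by blast
  have "rec_eval (Comp neg [Comp solve [build]]) [enc_input nf nc np (C, hpos, hneg)]
      (if selective \<Sigma> \<D> C (set hpos) (set hneg) = {} then 1 else 0)"
    if inst: "csu_instance \<Sigma> \<D> PP ar C (set hpos) (set hneg)" for C hpos hneg
  proof -
    define x where "x = enc_input nf nc np (C, hpos, hneg)"
    let ?\<phi> = "decision_fm (eq_sym \<Sigma>) (Suc x) C hpos hneg"
    note D = csu_instanceD[OF inst]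
    have bound: "\<forall>H\<in>insert C (set hpos \<union> set hneg). vars_catom H \<subseteq> {..<Suc x}"
    proof (intro ballI subsetI)
      fix H y assume "H \<in> insert C (set hpos \<union> set hneg)" "y \<in> vars_catom H"
      then show "y \<in> {..<Suc x}"
        using le_trans[OF vars_catom_le_enc enc_catom_le_enc_input, of y H C hpos hneg nf nc np]
        by (simp add: x_def less_Suc_eq_le)
    qed
    have "length (args_of C) \<le> Suc x"
      using le_trans[OF length_args_le_enc enc_catom_le_enc_input, of C C hpos hneg nf nc np]
      by (simp add: x_def)
    with D(4) have "satisfiable \<D> ?\<phi> \<longleftrightarrow> selective \<Sigma> \<D> C (set hpos) (set hneg) \<noteq> {}"
      unfolding selective_nonempty_iff[OF assms(1,2) inst bound]
      by (intro satisfiable_decision_fm[OF assms(2) bound]) auto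
    \<comment> \<open>The solver is only guaranteed to answer on codes of constraints.\<close>
    moreover have "is_constraint \<Sigma> ?\<phi>"
      using D(1) inst by (intro is_constraint_decision_fm[OF assms(1)]) (auto simp: csu_instance_def)
    moreover have "decision_code (nc (eq_sym \<Sigma>)) x = enc_fm nf nc ?\<phi>"
      by (rule decision_code[OF x_def])
    ultimately have "rec_eval (Comp solve [build]) [x] (if selective \<Sigma> \<D> C (set hpos) (set hneg) \<noteq> {} then 1 else 0)"
      using rec_eval_Comp1[OF build[of x], of solve] solve[of ?\<phi>] by simp
    from rec_eval_Comp1[OF this neg] show ?thesis by (simp add: x_def split: if_splits)
  qed
  then show ?thesis unfolding decidable_on_def by (intro exI[of _ "Comp neg [Comp solve [build]]"]) auto
qed

end
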